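(* Under the condition that $W\cdot\tilde h_j^{(i)}\approx 0$ and $W\cdot h_j^{(i)}\approx 0$, where $W$ is the first linear transformation in the prediction head $F'$, $h_j^{(i)}$ is the up-to-date embedding and $\tilde h_j^{(i)}$ the historical embedding of segment $j$ of graph $i$, Stale Embedding Dropout (SED) with a keep ratio $p$ ensures to reduce the bias term introduced by historical embeddings by a factor of $p$, while introducing another regularization term. (The bias and regularization terms are the first- and second-order Taylor terms described in the context, and the comparison is with using the embedding table without SED.)
   Context: Setting. A graph $\mathcal G^{(i)}$ with label $y^{(i)}$ is partitioned into $J^{(i)}$ segments $\mathcal G_j^{(i)}$. A backbone graph neural network $F$ gives the up-to-date segment embedding $h_j^{(i)}=F(\mathcal G_j^{(i)})$. A table of historical embeddings stores, for each segment, an embedding $\tilde h_j^{(i)}$ computed at an earlier training iteration, which may be stale (not up to date with the current $F$). The symbol $\bigoplus$ denotes aggregation over segments (mean or sum of vectors). The prediction head $F'$ maps the aggregated graph embedding to a prediction, and $\mathcal L$ is the loss (the label is suppressed in the notation). Training with the embedding table (ET, no dropout). At each iteration $S^{(i)}$ of the $J^{(i)}$ segments are randomly sampled for backpropagation, each segment being selected with probability $S^{(i)}/J^{(i)}$. Sampled segments, indexed by $s$, use up-to-date embeddings $h_s^{(i)}$; the other segments use $\tilde h_j^{(i)}$. The aggregate of both sets is written $h_s^{(i)}\bigoplus\tilde h_j^{(i)}$. SED with keep ratio (keep probability) $p$. Each segment embedding is multiplied by a weight $\eta^{(i)}$: for a sampled segment, $\eta^{(i)}=p+(1-p)\frac{J^{(i)}}{S^{(i)}}$;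 for a segment not sampled, $\eta^{(i)}=0$ with probability $1-p$ (its stale embedding is dropped) and $\eta^{(i)}=1$ with probability $p$. Perturbation. $\delta^{(i)}$ is the difference between the aggregated embedding used in training and $\bigoplus h_j^{(i)}$, and $\delta_j^{(i)}$ is the corresponding perturbation of the embedding of segment $j$. For ET, $\delta_j^{(i)}=0$ with probability $\frac{S^{(i)}}{J^{(i)}}$ and $\delta_j^{(i)}=\tilde h_j^{(i)}-h_j^{(i)}$ with probability $\frac{J^{(i)}-S^{(i)}}{J^{(i)}}$. For SED, $\delta_j^{(i)}=\frac{(1-p)(J^{(i)}-S^{(i)})}{S^{(i)}}h_j^{(i)}$ with probability $\frac{S^{(i)}}{J^{(i)}}$, $\delta_j^{(i)}=-h_j^{(i)}$ with probability $\frac{(1-p)(J^{(i)}-S^{(i)})}{J^{(i)}}$, and $\delta_j^{(i)}=\tilde h_j^{(i)}-h_j^{(i)}$ with probability $\frac{p(J^{(i)}-S^{(i)})}{J^{(i)}}$. Bias and regularization terms. Write $D^k_{a}f[a_0]$ for the $k$-th derivative of $f$ with respect to $a$ evaluated at $a_0$. Taylor expansion of the loss around $\delta_j^{(i)}=0$ gives the approximation $$\mathbb E_s\,\mathcal L\big(F'(h_s^{(i)}\textstyle\bigoplus\tilde h_j^{(i)})\big)-\mathcal L\big(F'(\bigoplus h_j^{(i)})\big)\approx\sum_j\mathbb E_{\delta_j^{(i)}}\,[B+R],$$ $$B=D_{h_j^{(i)}}(\mathcal L\circ F')[h_j^{(i)}]\,\delta_j^{(i)},\qquad R=\tfrac12\,{\delta_j^{(i)}}^{\top}\big(D^2_{h_j^{(i)}}(\mathcal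 L\circ F')[h_j^{(i)}]\big)\delta_j^{(i)},$$ where, for SED, the embeddings on the left-hand side are weighted by $\eta^{(i)}$. The first-order term $B$, in expectation over $\delta_j^{(i)}$, acts as the bias term introduced by the stale historical embeddings; the second-order term $R$, in expectation, acts as an additional regularizer. The effects of ET and SED are compared by substituting the respective $\delta_j^{(i)}$ into these terms. The paper uses the condition on $W$ to support the Taylor expansion: when it holds, the perturbation of the loss caused by $\delta^{(i)}$ might not be too large. *)

theory Defs
  imports "HOL-Analysis.Analysis" "HOL-Probability.Probability"
begin

text \<open>One graph is considered, with segments \<open>0, \<dots>, J - 1\<close>. Its up-to-date and historical
  segment embeddings are families \<open>h\<close> and \<open>hs\<close> of vectors; their values at indices \<open>j \<ge> J\<close> are
  never used.\<close>

datatype aggregation = Mean | Sum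

fun aggregate :: "aggregation \<Rightarrow> nat \<Rightarrow> (nat \<Rightarrow> 'a::real_vector) \<Rightarrow> 'a" where
  "aggregate Mean J v = (1 / real J) *\<^sub>R (\<Sum>j<J. v j)"
| "aggregate Sum J v = (\<Sum>j<J. v j)"


subsection \<open>Random selection of segments and stale embedding dropout\<close>

text \<open>The law of the random set of sampled segments. Only the marginal selection probabilities
  are prescribed; the uniform distribution on the \<open>S\<close>-element subsets is the standard instance
  (\<open>sampling_scheme_uniform\<close>).\<close>

definition sampling_scheme :: "nat \<Rightarrow> nat \<Rightarrow> nat set pmf \<Rightarrow> bool" where
  "sampling_scheme J S P \<longleftrightarrow>
     set_pmf P \<subseteq> {A. A \<subseteq> {..<J} \<and> card A = S} \<and>
     (\<forall>j<J. measure_pmf.prob P {A. j \<in> A} = real S / real J)"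

lemma sampling_scheme_uniform:
  assumes "0 < S" "S \<le> J"
  shows "sampling_scheme J S (pmf_of_set {A. A \<subseteq> {..<J} \<and> card A = S})"
proof -
  let ?X = "{A. A \<subseteq> {..<J} \<and> card A = S}"
  have cX: "card ?X = J choose S" using n_subsets[of "{..<J}" S] by simp
  have fX: "finite ?X" by (rule finite_subset[of _ "Pow {..<J}"]) auto
  have nX: "?X \<noteq> {}" using cX assms by (intro notI) simp
  have "measure_pmf.prob (pmf_of_set ?X) {A. j \<in> A} = real S / real J" if j: "j < J" for j
  proof -
    let ?Y = "{B. B \<subseteq> {..<J} - {j} \<and> card B = S - 1}"
    have "?X \<inter> {A. j \<in> A} = insert j ` ?Y"
    proof (intro equalityI subsetI)
      fix A assume A: "A \<in> ?X \<inter> {A. j \<in> A}"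
      then have "finite A" by (auto intro: finite_subset)
      with A have "A - {j} \<in> ?Y" "A = insert j (A - {j})" by auto
      then show "A \<in> insert j ` ?Y" by blast
    next
      fix A assume "A \<in> insert j ` ?Y"
      then obtain B where B: "B \<subseteq> {..<J} - {j}" "card B = S - 1" "A = insert j B" by auto
      then have "finite B" "j \<notin> B" by (auto intro: finite_subset)
      with B j assms show "A \<in> ?X \<inter> {A. j \<in> A}" by auto
    qed
    moreover have "inj_on (insert j) ?Y"
      by (rule inj_on_inverseI[where g = "\<lambda>A. A - {j}"]) auto
    ultimately have c: "card (?X \<inter> {A. j \<in> A}) = (J - 1) choose (S - 1)"
      using n_subsets[of "{..<J} - {j}" "S - 1"] j by (simp add: card_image)
    have "S * (J choose S) = J * ((J - 1) choose (S - 1))"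
      using binomial_absorption[of "S - 1" J] assms by simp
    then have "real S * real (J choose S) = real J * real ((J - 1) choose (S - 1))"
      by (metis of_nat_mult)
    moreover have "real (J choose S) > 0" using assms by simp
    ultimately have "real ((J - 1) choose (S - 1)) / real (J choose S) = real S / real J"
      using j by (simp add: frac_eq_eq mult.commute)
    then show ?thesis
      using measure_pmf_of_set[OF nX fX, of "{A. j \<in> A}"] by (simp only: c cX)
  qed
  then show ?thesis
    using nX fX by (simp add: sampling_scheme_def)
qed

definition et_embedding :: "(nat \<Rightarrow> 'a) \<Rightarrow> (nat \<Rightarrow> 'a) \<Rightarrow> nat set \<Rightarrow> nat \<Rightarrow> 'a" where
  "et_embedding h hs A j = (if j \<in> A then h j else hs j)"

text \<open>\<open>b j\<close> is the keep flag of segment \<open>j\<close>; it only matters when \<open>j\<close> is not sampled. Flags are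
  independent of each other and of the sampled set.\<close>

definition sed_pmf :: "real \<Rightarrow> nat \<Rightarrow> nat set pmf \<Rightarrow> (nat set \<times> (nat \<Rightarrow> bool)) pmf" where
  "sed_pmf p J P = pair_pmf P (Pi_pmf {..<J} False (\<lambda>_. bernoulli_pmf p))"

definition sed_weight :: "real \<Rightarrow> nat \<Rightarrow> nat \<Rightarrow> nat set \<Rightarrow> (nat \<Rightarrow> bool) \<Rightarrow> nat \<Rightarrow> real" where
  "sed_weight p J S A b j =
     (if j \<in> A then p + (1 - p) * (real J / real S) else if b j then 1 else 0)"

definition sed_embedding ::
  "real \<Rightarrow> nat \<Rightarrow> nat \<Rightarrow> (nat \<Rightarrow> 'a::real_vector) \<Rightarrow> (nat \<Rightarrow> 'a) \<Rightarrow> nat set \<times> (nat \<Rightarrow> bool) \<Rightarrow> nat \<Rightarrow> 'a" where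
  "sed_embedding p J S h hs = (\<lambda>(A, b) j. sed_weight p J S A b j *\<^sub>R et_embedding h hs A j)"


subsection \<open>Perturbation of a single segment embedding\<close>

text \<open>Here \<open>x\<close> and \<open>y\<close> are the up-to-date and the historical embedding of the segment. That these
  are the laws of the differences between the embedding used in training and \<open>x\<close> is shown
  in \<open>map_pmf_et_perturbation\<close> and \<open>map_pmf_sed_perturbation\<close> below.\<close>

definition et_perturbation :: "nat \<Rightarrow> nat \<Rightarrow> 'a::real_vector \<Rightarrow> 'a \<Rightarrow> 'a pmf" where
  "et_perturbation J S x y = pmf_of_list
     [(0,     real S / real J),
      (y - x, (real J - real S) / real J)]"

definition sed_perturbation :: "real \<Rightarrow> nat \<Rightarrow> nat \<Rightarrow> 'a::real_vector \<Rightarrow> 'a \<Rightarrow> 'a pmf" where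
  "sed_perturbation p J S x y = pmf_of_list
     [(((1 - p) * (real J - real S) / real S) *\<^sub>R x, real S / real J),
      (- x,    (1 - p) * (real J - real S) / real J),
      (y - x,  p * (real J - real S) / real J)]"


subsection \<open>Taylor terms\<close>

text \<open>Twice continuous (Frechet) differentiability.\<close>

definition C2 :: "('a::real_normed_vector \<Rightarrow> real) \<Rightarrow> bool" where
  "C2 f \<longleftrightarrow> (\<exists>(f' :: 'a \<Rightarrow> 'a \<Rightarrow>\<^sub>L real) (f'' :: 'a \<Rightarrow> 'a \<Rightarrow>\<^sub>L 'a \<Rightarrow>\<^sub>L real).
     (\<forall>x. (f has_derivative blinfun_apply (f' x)) (at x)) \<and>
     (\<forall>x. (f' has_derivative blinfun_apply (f'' x)) (at x)) \<and>
     continuous_on UNIV f'')"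

definition hessian :: "(real^'d \<Rightarrow> real) \<Rightarrow> real^'d \<Rightarrow> real^'d^'d" where
  "hessian f a = (\<chi> k l.
     frechet_derivative (\<lambda>x. frechet_derivative f (at x) (axis l 1)) (at a) (axis k 1))"

text \<open>The loss of the aggregated embedding, as a function of the embedding \<open>x\<close> of segment \<open>j\<close>
  alone, the other segments keeping their up-to-date embeddings. The argument \<open>l\<close> is the
  composition of the loss with the prediction head.\<close>

definition segment_loss ::
  "('a::real_vector \<Rightarrow> real) \<Rightarrow> aggregation \<Rightarrow> nat \<Rightarrow> (nat \<Rightarrow> 'a) \<Rightarrow> nat \<Rightarrow> 'a \<Rightarrow> real" where
  "segment_loss l agg J h j x = l (aggregate agg J (h(j := x)))"

definition bias_term ::
  "(real^'d \<Rightarrow> real) \<Rightarrow> aggregation \<Rightarrow> nat \<Rightarrow> (nat \<Rightarrow> real^'d) \<Rightarrow> nat \<Rightarrow> real^'d \<Rightarrow> real" where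
  "bias_term l agg J h j \<delta> = frechet_derivative (segment_loss l agg J h j) (at (h j)) \<delta>"

definition reg_term ::
  "(real^'d \<Rightarrow> real) \<Rightarrow> aggregation \<Rightarrow> nat \<Rightarrow> (nat \<Rightarrow> real^'d) \<Rightarrow> nat \<Rightarrow> real^'d \<Rightarrow> real" where
  "reg_term l agg J h j \<delta> = 1/2 * (\<delta> \<bullet> (hessian (segment_loss l agg J h j) (h j) *v \<delta>))"


subsection \<open>The perturbation laws come from the training procedure\<close>

lemma map_pmf_mem_sampling_scheme:
  assumes "sampling_scheme J S P" "j < J" "S \<le> J"
  shows "map_pmf (\<lambda>A. j \<in> A) P = bernoulli_pmf (real S / real J)"
proof (rule pmf_eqI)
  fix b
  have q: "real S / real J \<in> {0..1}" using assms by auto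
  have pr: "measure_pmf.prob P {A. j \<in> A} = real S / real J"
    using assms by (simp add: sampling_scheme_def)
  have "{A. j \<notin> A} = space (measure_pmf P) - {A. j \<in> A}" by auto
  then have pr': "measure_pmf.prob P {A. j \<notin> A} = 1 - real S / real J"
    using pr by (simp only: measure_pmf.prob_compl sets_measure_pmf UNIV_I)
  show "pmf (map_pmf (\<lambda>A. j \<in> A) P) b = pmf (bernoulli_pmf (real S / real J)) b"
    using q pr pr' by (cases b) (auto simp: pmf_map vimage_def)
qed

lemma map_pmf_et_perturbation:
  assumes "sampling_scheme J S P" "j < J" "S \<le> J"
  shows "map_pmf (\<lambda>A. et_embedding h hs A j - h j) P = et_perturbation J S (h j) (hs j)"
proof -
  have q: "0 \<le> real S / real J" "real S / real J \<le> 1" using assms by auto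
  have "map_pmf (\<lambda>A. et_embedding h hs A j - h j) P =
        map_pmf (\<lambda>b. if b then 0 else hs j - h j) (map_pmf (\<lambda>A. j \<in> A) P)"
    by (simp add: pmf.map_comp o_def et_embedding_def if_distrib[of "\<lambda>x. x - h j"] cong: if_cong)
  also have "\<dots> = map_pmf (\<lambda>b. if b then 0 else hs j - h j) (bernoulli_pmf (real S / real J))"
    by (simp add: map_pmf_mem_sampling_scheme[OF assms])
  also have "\<dots> = et_perturbation J S (h j) (hs j)"
  proof (rule pmf_eqI)
    fix x
    have wf: "pmf_of_list_wf [(0, real S / real J), (hs j - h j, (real J - real S) / real J)]"
      using assms by (auto simp: pmf_of_list_wf_def field_simps)
    have c: "(real J - real S) / real J = 1 - real S / real J"
      using assms by (simp add: field_simps)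
    show "pmf (map_pmf (\<lambda>b. if b then 0 else hs j - h j) (bernoulli_pmf (real S / real J))) x =
          pmf (et_perturbation J S (h j) (hs j)) x"
      unfolding et_perturbation_def pmf_pmf_of_list[OF wf] map_pmf_def pmf_bind
      using q by (auto simp: c pmf_return indicator_def)
  qed
  finally show ?thesis .
qed

lemma map_pmf_sed_perturbation:
  assumes "sampling_scheme J S P" "j < J" "0 < S" "S \<le> J" "0 \<le> p" "p \<le> 1"
  shows "map_pmf (\<lambda>\<omega>. sed_embedding p J S h hs \<omega> j - h j) (sed_pmf p J P) =
         sed_perturbation p J S (h j) (hs j)"
proof -
  define g where "g = (\<lambda>(a, b). if a then ((1 - p) * (real J - real S) / real S) *\<^sub>R h j
                           else if b then hs j - h j else - h j)"
  have q: "0 \<le> real S / real J" "real S / real J \<le> 1" using assms by auto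
  have w: "(p + (1 - p) * real J / real S) *\<^sub>R h j - h j
           = ((1 - p) * (real J - real S) / real S) *\<^sub>R h j"
  proof -
    have "(1 - p) * (real J - real S) / real S = (p + (1 - p) * real J / real S) - 1"
      using assms by (simp add: field_simps)
    then show ?thesis by (simp add: scaleR_left_diff_distrib)
  qed
  have "(\<lambda>\<omega>. sed_embedding p J S h hs \<omega> j - h j) = g \<circ> map_prod (\<lambda>A. j \<in> A) (\<lambda>b. b j)"
    by (auto simp: fun_eq_iff sed_embedding_def sed_weight_def et_embedding_def g_def w)
  then have "map_pmf (\<lambda>\<omega>. sed_embedding p J S h hs \<omega> j - h j) (sed_pmf p J P) =
     map_pmf g (pair_pmf (map_pmf (\<lambda>A. j \<in> A) P)
       (map_pmf (\<lambda>b. b j) (Pi_pmf {..<J} False (\<lambda>_. bernoulli_pmf p))))"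
    by (simp only: sed_pmf_def pmf.map_comp[symmetric] map_prod_def map_pair)
  also have "\<dots> = map_pmf g (pair_pmf (bernoulli_pmf (real S / real J)) (bernoulli_pmf p))"
    using assms by (simp add: map_pmf_mem_sampling_scheme Pi_pmf_component)
  also have "\<dots> = sed_perturbation p J S (h j) (hs j)"
  proof (rule pmf_eqI)
    fix x
    have wf: "pmf_of_list_wf
     [(((1 - p) * (real J - real S) / real S) *\<^sub>R h j, real S / real J),
      (- h j,    (1 - p) * (real J - real S) / real J),
      (hs j - h j,  p * (real J - real S) / real J)]"
    proof -
      have "0 \<le> (1 - p) * (real J - real S) / real J" "0 \<le> p * (real J - real S) / real J"
        using assms by auto
      moreover have "real S / real J + ((1 - p) * (real J - real S) / real J
          + p * (real J - real S) / real J) = 1"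
        using assms by (simp add: field_simps)
      ultimately show ?thesis
        by (auto simp: pmf_of_list_wf_def)
    qed
    define r where "r = real S / real J"
    have r: "0 \<le> r" "r \<le> 1" using q by (simp_all add: r_def)
    have c: "(1 - p) * (real J - real S) / real J = (1 - r) * (1 - p)"
            "p * (real J - real S) / real J = (1 - r) * p"
      using assms by (simp_all add: r_def field_simps)
    define u where "u = ((1 - p) * (real J - real S) / real S) *\<^sub>R h j"
    have "map_pmf g (pair_pmf (bernoulli_pmf r) (bernoulli_pmf p)) =
      bind_pmf (bernoulli_pmf r) (\<lambda>a. bind_pmf (bernoulli_pmf p) (\<lambda>b. return_pmf (g (a, b))))"
      by (simp add: map_pmf_def pair_pmf_def bind_assoc_pmf bind_return_pmf)
    then have "pmf (map_pmf g (pair_pmf (bernoulli_pmf r) (bernoulli_pmf p))) x =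
      r * of_bool (u = x)
      + (1 - r) * (p * of_bool (hs j - h j = x) + (1 - p) * of_bool (- h j = x))"
      using r assms by (simp add: pmf_bind pmf_return indicator_def g_def flip: u_def)
    also have "\<dots> = pmf (sed_perturbation p J S (h j) (hs j)) x"
      unfolding sed_perturbation_def pmf_pmf_of_list[OF wf] unfolding c r_def[symmetric] u_def[symmetric]
      by (auto simp: algebra_simps)
    finally show "pmf (map_pmf g (pair_pmf (bernoulli_pmf (real S / real J)) (bernoulli_pmf p))) x =
          pmf (sed_perturbation p J S (h j) (hs j)) x"
      by (simp add: r_def)
  qed
  finally show ?thesis .
qed

end

theory Submission
  imports Defs
begin

text \<open>The loss depends on a segment embedding only through its image under \<open>W\<close>, and all these
  images, whether up to date, stale or reweighted, have size \<open>O(\<epsilon>)\<close>. Hence the second-order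
  remainder and the term \<open>R\<close> itself are both \<open>O(\<epsilon>\<^sup>2)\<close>, with a constant governed by the second
  derivative of \<open>L \<circ> G\<close> on a fixed ball, while the first-order terms of the
  different segments add up exactly by linearity of the derivative and of the expectation,
  although the perturbations of different segments are dependent. The weight of the sampled
  segments is chosen so that its contribution to the mean of the SED perturbation cancels that
  of the dropped stale embeddings, which leaves \<open>p\<close> times the mean of the ET perturbation.\<close>

section \<open>Mean and sum as one weighted sum\<close>

definition aggregation_weight :: "aggregation \<Rightarrow> nat \<Rightarrow> real" where
  "aggregation_weight agg J = (case agg of Mean \<Rightarrow> 1 / real J | Sum \<Rightarrow> 1)"

lemma aggregate_eq: "aggregate agg J v = aggregation_weight agg J *\<^sub>R (\<Sum>j<J. v j)"
  by (cases agg) (auto simp: aggregation_weight_def)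

text \<open>The upper bound 1 lets the same norm estimates serve for mean and sum: multiplying by
  the weight never enlarges a vector.\<close>

lemma aggregation_weight_bounds:
  "0 < J \<Longrightarrow> 0 \<le> aggregation_weight agg J" "0 < J \<Longrightarrow> aggregation_weight agg J \<le> 1"
  by (cases agg; simp add: aggregation_weight_def)+

text \<open>This makes the loss in one segment embedding an affine map followed by the loss, so the
  chain rule applies directly.\<close>

lemma aggregate_fun_upd:
  assumes "j < J"
  shows "aggregate agg J (h(j := x)) = aggregate agg J h + aggregation_weight agg J *\<^sub>R (x - h j)"
proof -
  have "(\<Sum>i<J. (h(j := x)) i) = x + (\<Sum>i\<in>{..<J} - {j}. h i)"
    using assms by (subst sum.remove[of _ j]) (auto intro: sum.cong)
  moreover have "(\<Sum>i<J. h i) = h j + (\<Sum>i\<in>{..<J} - {j}. h i)"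
    using assms by (subst sum.remove[of _ j]) auto
  ultimately show ?thesis
    by (simp add: aggregate_eq algebra_simps)
qed

section \<open>Expectations under the ET and SED perturbation laws\<close>

lemma integral_pmf_of_list:
  fixes g :: "'a \<Rightarrow> real"
  assumes "pmf_of_list_wf xs"
  shows "measure_pmf.expectation (pmf_of_list xs) g = (\<Sum>(x, q)\<leftarrow>xs. q * g x)"
proof -
  have "measure_pmf.expectation (pmf_of_list xs) g =
    (\<Sum>x\<in>set (map fst xs). pmf (pmf_of_list xs) x * g x)"
    using set_pmf_of_list[OF assms]
    by (subst integral_measure_pmf[where A = "set (map fst xs)"]) auto
  \<comment> \<open>\<open>pmf_of_list\<close> merges equal entries, and perturbation values may
    coincide (\<open>- x\<close> and \<open>y - x\<close> when \<open>y = 0\<close>). Writing each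
    point mass as a sum over list positions and swapping the sums undoes the merging.\<close>
  also have "\<dots> = (\<Sum>x\<in>set (map fst xs). \<Sum>z\<leftarrow>xs. (if fst z = x then snd z * g x else 0))"
    by (intro sum.cong refl)
      (auto simp: pmf_pmf_of_list[OF assms] sum_list_map_filter'[symmetric]
        sum_list_mult_const[symmetric] if_distrib[of "\<lambda>a. a * _"] cong: if_cong
        intro!: arg_cong[of _ _ sum_list])
  also have "\<dots> = (\<Sum>z\<leftarrow>xs. snd z * g (fst z))"
    by (simp add: sum_list_sum_nth, subst sum.swap) (auto intro!: sum.cong)
  finally show ?thesis
    by (simp add: case_prod_unfold)
qed

lemma expectation_et_perturbation:
  fixes g :: "'a::real_vector \<Rightarrow> real"
  assumes "0 < S" "S \<le> J"
  shows "measure_pmf.expectation (et_perturbation J S x y) g =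
    real S / real J * g 0 + (real J - real S) / real J * g (y - x)"
proof -
  have "pmf_of_list_wf [(0, real S / real J), (y - x, (real J - real S) / real J)]"
    using assms by (auto simp: pmf_of_list_wf_def field_simps)
  then show ?thesis
    by (simp add: et_perturbation_def integral_pmf_of_list)
qed

lemma expectation_sed_perturbation:
  fixes g :: "'a::real_vector \<Rightarrow> real"
  assumes "0 < S" "S \<le> J" "0 \<le> p" "p \<le> 1"
  shows "measure_pmf.expectation (sed_perturbation p J S x y) g =
    real S / real J * g (((1 - p) * (real J - real S) / real S) *\<^sub>R x)
    + (1 - p) * (real J - real S) / real J * g (- x)
    + p * (real J - real S) / real J * g (y - x)"
proof -
  have "0 \<le> (1 - p) * (real J - real S) / real J" "0 \<le> p * (real J - real S) / real J"
    using assms by auto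
  moreover have "real S / real J + ((1 - p) * (real J - real S) / real J
      + p * (real J - real S) / real J) = 1"
    using assms by (simp add: field_simps)
  ultimately have "pmf_of_list_wf
     [(((1 - p) * (real J - real S) / real S) *\<^sub>R x, real S / real J),
      (- x, (1 - p) * (real J - real S) / real J),
      (y - x, p * (real J - real S) / real J)]"
    by (auto simp: pmf_of_list_wf_def)
  then show ?thesis
    by (simp add: sed_perturbation_def integral_pmf_of_list)
qed

text \<open>The sampled branch contributes \<open>(1 - p) * (J - S) / J * g x\<close> and the
  dropped branch its negative. As \<open>g 0 = 0\<close>, only the stale branch remains on either
  side.\<close>

lemma expectation_sed_perturbation_linear:
  fixes g :: "'a::real_vector \<Rightarrow> real"
  assumes "linear g" "0 < S" "S \<le> J" "0 \<le> p" "p \<le> 1"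
  shows "measure_pmf.expectation (sed_perturbation p J S x y) g =
    p * measure_pmf.expectation (et_perturbation J S x y) g"
  using assms(2-)
  by (simp add: expectation_sed_perturbation expectation_et_perturbation linear_cmul[OF assms(1)]
      linear_neg[OF assms(1)] linear_0[OF assms(1)])

text \<open>A quadratic \<open>g\<close> is even, so the sampled and dropped branches, which cancel
  for linear \<open>g\<close>, now add up. Factoring \<open>(1 - p) * (J - S) / J\<close> out of
  their sum leaves \<open>(1 - p) * (J - S) / S + 1\<close>, the source of the extra
  coefficient.\<close>

lemma expectation_sed_perturbation_quadratic:
  fixes g :: "'a::real_vector \<Rightarrow> real"
  assumes quadratic: "\<And>c x. g (c *\<^sub>R x) = c\<^sup>2 * g x"
    and "0 < S" "S \<le> J" "0 \<le> p" "p \<le> 1"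
  shows "measure_pmf.expectation (sed_perturbation p J S x y) g =
    p * measure_pmf.expectation (et_perturbation J S x y) g
    + (1 - p) * (real J - real S) / real J
      * (((1 - p) * (real J - real S) + real S) / real S) * g x"
proof -
  have "g (- x) = g x" "g 0 = 0"
    using quadratic[of "-1" x] quadratic[of 0 x] by simp_all
  moreover have "real S / real J * (((1 - p) * (real J - real S) / real S)\<^sup>2 * g x)
      + (1 - p) * (real J - real S) / real J * g x
    = (1 - p) * (real J - real S) / real J
      * (((1 - p) * (real J - real S) + real S) / real S) * g x"
    using assms(2,3) by (simp add: divide_simps power2_eq_square) (simp add: algebra_simps)
  ultimately show ?thesis
    using assms(2-) by (simp add: expectation_sed_perturbation expectation_et_perturbation quadratic)
qed

lemma reg_term_scaleR: "reg_term l agg J h j (c *\<^sub>R \<delta>) = c\<^sup>2 * reg_term l agg J h j \<delta>"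
  by (simp add: reg_term_def power2_eq_square matrix_vector_mult_scaleR)

section \<open>First-order Taylor remainder along a segment\<close>

lemma first_order_remainder_bound:
  fixes f :: "'a::real_normed_vector \<Rightarrow> real" and f' :: "'a \<Rightarrow> 'a \<Rightarrow>\<^sub>L real"
    and f'' :: "'a \<Rightarrow> 'a \<Rightarrow>\<^sub>L 'a \<Rightarrow>\<^sub>L real"
  assumes f': "\<And>x. (f has_derivative blinfun_apply (f' x)) (at x)"
    and f'': "\<And>x. (f' has_derivative blinfun_apply (f'' x)) (at x)"
    and M: "\<And>x. x \<in> closed_segment a b \<Longrightarrow> norm (f'' x) \<le> M"
  shows "\<bar>f b - f a - blinfun_apply (f' a) (b - a)\<bar> \<le> M * (norm (b - a))\<^sup>2"
proof -
  have M0: "0 \<le> M"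
    by (intro order_trans[OF norm_ge_zero M[of a]]) simp
  have df: "norm (f' x - f' a) \<le> M * norm (b - a)" if x: "x \<in> closed_segment a b" for x
  proof -
    have "norm (f' x - f' a) \<le> M * norm (x - a)"
      using x M
      by (intro differentiable_bound[where S = "closed_segment a b" and f' = "\<lambda>x. blinfun_apply (f'' x)"])
        (auto intro: has_derivative_at_withinI f'' simp: norm_blinfun.rep_eq[symmetric])
    also have "\<dots> \<le> M * norm (b - a)"
      using segment_bound(1)[OF x] M0 by (intro mult_left_mono) auto
    finally show ?thesis .
  qed
  \<comment> \<open>Second use of the mean value inequality: subtracting the linearization at
    \<open>a\<close> leaves the derivative \<open>f' x - f' a\<close>, already bounded by
    \<open>df\<close>. This yields the constant \<open>M\<close> rather than the sharp
    \<open>M / 2\<close>, which suffices for an order estimate.\<close>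
  have "norm ((f b - blinfun_apply (f' a) b) - (f a - blinfun_apply (f' a) a))
      \<le> M * norm (b - a) * norm (b - a)"
  proof (rule differentiable_bound[where S = "closed_segment a b"
        and f = "\<lambda>x. f x - blinfun_apply (f' a) x" and f' = "\<lambda>x. blinfun_apply (f' x - f' a)"])
    show "((\<lambda>x. f x - blinfun_apply (f' a) x) has_derivative blinfun_apply (f' x - f' a))
        (at x within closed_segment a b)" for x
      unfolding blinfun.diff_left
      by (intro has_derivative_diff has_derivative_at_withinI[OF f']
          bounded_linear_imp_has_derivative blinfun.bounded_linear_right)
    show "onorm (blinfun_apply (f' x - f' a)) \<le> M * norm (b - a)" if "x \<in> closed_segment a b" for x
      using df[OF that] by (simp add: norm_blinfun.rep_eq)
  qed auto
  then show ?thesis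
    by (simp add: blinfun.diff_right power2_eq_square algebra_simps)
qed

section \<open>Derivatives of the loss in one segment, and the expected loss\<close>

context
  fixes f :: "real^'m \<Rightarrow> real" and f' :: "real^'m \<Rightarrow> (real^'m) \<Rightarrow>\<^sub>L real"
    and f'' :: "real^'m \<Rightarrow> (real^'m) \<Rightarrow>\<^sub>L (real^'m) \<Rightarrow>\<^sub>L real"
    and W :: "real^'d^'m" and agg :: aggregation and J :: nat and h :: "nat \<Rightarrow> real^'d"
  assumes f': "\<And>x. (f has_derivative blinfun_apply (f' x)) (at x)"
    and f'': "\<And>x. (f' has_derivative blinfun_apply (f'' x)) (at x)"
begin

text \<open>Here \<open>f\<close> stands for \<open>L \<circ> G\<close>, \<open>z\<close> is its
  argument at the unperturbed embeddings, and \<open>T \<delta>\<close> is the displacement of that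
  argument when one segment moves by \<open>\<delta>\<close>.\<close>

private abbreviation (input) "l \<equiv> \<lambda>x. f (W *v x)"
private abbreviation (input) "z \<equiv> W *v aggregate agg J h"
private abbreviation (input) "T \<delta> \<equiv> aggregation_weight agg J *\<^sub>R (W *v \<delta>)"

lemma bounded_linear_scaled_matrix: "bounded_linear (\<lambda>\<delta>. T \<delta>)"
  by (intro bounded_linear_compose[OF bounded_linear_scaleR_right] matrix_vector_mul_bounded_linear)

lemma segment_loss_eq:
  assumes "j < J"
  shows "segment_loss l agg J h j = (\<lambda>x. f (z + T (x - h j)))"
  using assms
  by (simp add: segment_loss_def fun_eq_iff aggregate_fun_upd matrix_vector_right_distrib
      matrix_vector_mult_scaleR)

lemma has_derivative_segment_argument:
  "((\<lambda>x. z + T (x - h j)) has_derivative (\<lambda>\<delta>. T \<delta>)) (at x)"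
proof -
  have "((\<lambda>x. z + T (x - h j)) has_derivative (\<lambda>\<delta>. 0 + T (\<delta> - 0))) (at x)"
    by (intro has_derivative_add has_derivative_const
        bounded_linear.has_derivative[OF bounded_linear_scaled_matrix] has_derivative_diff has_derivative_ident)
  then show ?thesis by simp
qed

lemma frechet_derivative_segment_loss:
  assumes "j < J"
  shows "frechet_derivative (segment_loss l agg J h j) (at x) =
    (\<lambda>\<delta>. blinfun_apply (f' (z + T (x - h j))) (T \<delta>))"
  unfolding segment_loss_eq[OF assms]
  by (rule frechet_derivative_at[symmetric],
      rule has_derivative_compose[OF has_derivative_segment_argument f'])

lemma bias_term_eq:
  assumes "j < J"
  shows "bias_term l agg J h j \<delta> = blinfun_apply (f' z) (T \<delta>)"
  using assms by (simp add: bias_term_def frechet_derivative_segment_loss)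

lemma linear_bias_term:
  assumes "j < J"
  shows "linear (bias_term l agg J h j)"
  unfolding bias_term_eq[OF assms, abs_def]
  by (intro bounded_linear.linear bounded_linear_compose[OF blinfun.bounded_linear_right]
      bounded_linear_scaled_matrix)

lemma hessian_segment_loss:
  assumes "j < J"
  shows "hessian (segment_loss l agg J h j) (h j) $ k $ i =
    blinfun_apply (blinfun_apply (f'' z) (T (axis k 1))) (T (axis i 1))"
proof -
  have "((\<lambda>x. blinfun_apply (f' (z + T (x - h j))) (T (axis i 1))) has_derivative
      (\<lambda>\<delta>. blinfun_apply (blinfun_apply (f'' (z + T (h j - h j))) (T \<delta>)) (T (axis i 1)))) (at (h j))"
    by (rule bounded_linear.has_derivative[OF blinfun.bounded_linear_left],
        rule has_derivative_compose[OF has_derivative_segment_argument f''])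
  from frechet_derivative_at[OF this, symmetric] show ?thesis
    by (simp add: hessian_def frechet_derivative_segment_loss[OF assms])
qed

text \<open>Passing from the Hessian matrix to the bilinear map \<open>f'' z\<close> allows operator
  norm bounds in terms of \<open>W\<close>. The two agree by expanding \<open>\<delta>\<close> in
  the standard basis.\<close>

lemma reg_term_eq:
  assumes "j < J"
  shows "reg_term l agg J h j \<delta> = 1/2 * blinfun_apply (blinfun_apply (f'' z) (T \<delta>)) (T \<delta>)"
proof -
  have expand: "T \<delta> = (\<Sum>i\<in>UNIV. \<delta> $ i *\<^sub>R T (axis i 1))"
  proof -
    have "T \<delta> = T (\<Sum>i\<in>UNIV. \<delta> $ i *\<^sub>R axis i 1)"
      using basis_expansion[of \<delta>] by (simp add: scalar_mult_eq_scaleR)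
    also have "\<dots> = (\<Sum>i\<in>UNIV. \<delta> $ i *\<^sub>R T (axis i 1))"
      by (simp only: linear_sum[OF matrix_vector_mul_linear] matrix_vector_mult_scaleR
          scaleR_sum_right scaleR_left_commute[of "aggregation_weight agg J"])
    finally show ?thesis .
  qed
  have "blinfun_apply (blinfun_apply (f'' z) (T \<delta>)) (T \<delta>) =
    (\<Sum>k\<in>UNIV. \<delta> $ k * (\<Sum>i\<in>UNIV.
      blinfun_apply (blinfun_apply (f'' z) (T (axis k 1))) (T (axis i 1)) * \<delta> $ i))"
    by (subst (1 2) expand)
      (simp only: blinfun.sum_left blinfun.sum_right blinfun.scaleR_left blinfun.scaleR_right
        real_scaleR_def sum_distrib_left, subst sum.swap, simp only: mult_ac)
  moreover have "(A *v \<delta>) $ k = (\<Sum>i\<in>UNIV. A $ k $ i * \<delta> $ i)" for A :: "real^'d^'d" and k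
    by (simp add: matrix_vector_mult_def)
  ultimately show ?thesis
    by (simp only: reg_term_def inner_vec_def hessian_segment_loss[OF assms] inner_real_def)
qed

text \<open>Abstracting the training embeddings to any \<open>e\<close> on a finitely supported
  \<open>Q\<close> treats ET and SED at once. Only the marginal laws \<open>D j\<close> enter, since
  each Taylor term involves a single segment. One \<open>M * (real J * \<eta>)\<^sup>2\<close> pays
  for the joint first-order remainder, the other for the sum of the terms \<open>R\<close>.\<close>

lemma expected_loss_taylor_bound:
  fixes e :: "'w \<Rightarrow> nat \<Rightarrow> real^'d"
  assumes J: "0 < J" and fin: "finite (set_pmf Q)"
    and law: "\<And>j. j < J \<Longrightarrow> map_pmf (\<lambda>\<omega>. e \<omega> j - h j) Q = D j"
    and M: "\<And>x. norm x \<le> r \<Longrightarrow> norm (f'' x) \<le> M"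
    and h: "\<And>j. j < J \<Longrightarrow> norm (W *v h j) \<le> \<eta>"
    and e: "\<And>\<omega> j. \<omega> \<in> set_pmf Q \<Longrightarrow> j < J \<Longrightarrow> norm (W *v (e \<omega> j - h j)) \<le> \<eta>"
    and r: "2 * real J * \<eta> \<le> r"
  shows "\<bar>measure_pmf.expectation Q (\<lambda>\<omega>. l (aggregate agg J (e \<omega>))) - l (aggregate agg J h)
    - (\<Sum>j<J. measure_pmf.expectation (D j)
        (\<lambda>\<delta>. bias_term l agg J h j \<delta> + reg_term l agg J h j \<delta>))\<bar> \<le> 2 * M * (real J * \<eta>)\<^sup>2"
proof -
  define \<Delta> where "\<Delta> = (\<lambda>\<omega> j. T (e \<omega> j - h j))"
  \<comment> \<open>The remainder of moving all segments simultaneously, so that every interaction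
    between segments is contained in it.\<close>
  define rem where "rem = (\<lambda>\<omega>. f (z + (\<Sum>j<J. \<Delta> \<omega> j)) - f z - blinfun_apply (f' z) (\<Sum>j<J. \<Delta> \<omega> j))"
  have int [simp]: "integrable (measure_pmf Q) g" for g :: "'w \<Rightarrow> real"
    by (rule integrable_measure_pmf_finite[OF fin])
  have eta: "0 \<le> \<eta>"
    using h[OF J] norm_ge_zero[of "W *v h 0"] by linarith
  have shrink: "norm (aggregation_weight agg J *\<^sub>R v) \<le> norm v" for v :: "real^'m"
    using aggregation_weight_bounds[OF J, of agg] by (simp add: mult_left_le_one_le)
  have z: "norm z \<le> real J * \<eta>"
  proof -
    have "norm z \<le> norm (\<Sum>j<J. W *v h j)"
      using shrink[of "\<Sum>j<J. W *v h j"]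
      by (simp add: aggregate_eq matrix_vector_mult_scaleR linear_sum[OF matrix_vector_mul_linear])
    also have "\<dots> \<le> real J * \<eta>"
      using sum_norm_le[of "{..<J}" "\<lambda>j. W *v h j" "\<lambda>_. \<eta>"] h by simp
    finally show ?thesis .
  qed
  have \<Delta>: "norm (\<Delta> \<omega> j) \<le> \<eta>" if "\<omega> \<in> set_pmf Q" "j < J" for \<omega> j
    using e[OF that] shrink[of "W *v (e \<omega> j - h j)"] by (simp add: \<Delta>_def)
  have sum_\<Delta>: "norm (\<Sum>j<J. \<Delta> \<omega> j) \<le> real J * \<eta>" if "\<omega> \<in> set_pmf Q" for \<omega>
    using sum_norm_le[of "{..<J}" "\<Delta> \<omega>" "\<lambda>_. \<eta>"] \<Delta>[OF that] by simp
  have zr: "norm z \<le> r"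
    using z r mult_nonneg_nonneg[OF of_nat_0_le_iff eta, of J] by linarith
  have M0: "0 \<le> M"
    using M[OF zr] norm_ge_zero[of "f'' z"] by linarith
  have rem: "\<bar>rem \<omega>\<bar> \<le> M * (real J * \<eta>)\<^sup>2" if \<omega>: "\<omega> \<in> set_pmf Q" for \<omega>
  proof -
    \<comment> \<open>Both \<open>z\<close> and the total displacement have norm at most
      \<open>real J * \<eta>\<close>, so both endpoints lie in the ball of radius \<open>r\<close>,
      which is convex.\<close>
    have "closed_segment z (z + (\<Sum>j<J. \<Delta> \<omega> j)) \<subseteq> cball 0 r"
      using z zr r sum_\<Delta>[OF \<omega>] norm_triangle_ineq[of z "\<Sum>j<J. \<Delta> \<omega> j"]
      by (intro closed_segment_subset convex_cball) auto
    then have "\<bar>rem \<omega>\<bar> \<le> M * (norm (\<Sum>j<J. \<Delta> \<omega> j))\<^sup>2"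
      using first_order_remainder_bound[OF f' f'', of z "z + (\<Sum>j<J. \<Delta> \<omega> j)" M] M
      by (auto simp: rem_def subset_iff)
    also have "\<dots> \<le> M * (real J * \<eta>)\<^sup>2"
      using sum_\<Delta>[OF \<omega>] M0 by (intro mult_left_mono power_mono) auto
    finally show ?thesis .
  qed
  have reg: "\<bar>reg_term l agg J h j (e \<omega> j - h j)\<bar> \<le> M * \<eta>\<^sup>2" if \<omega>: "\<omega> \<in> set_pmf Q" and j: "j < J" for \<omega> j
  proof -
    have "\<bar>blinfun_apply (blinfun_apply (f'' z) (\<Delta> \<omega> j)) (\<Delta> \<omega> j)\<bar>
        \<le> norm (f'' z) * norm (\<Delta> \<omega> j) * norm (\<Delta> \<omega> j)"
      using norm_blinfun[of "blinfun_apply (f'' z) (\<Delta> \<omega> j)" "\<Delta> \<omega> j"] norm_blinfun[of "f'' z" "\<Delta> \<omega> j"]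
      by (smt (verit) mult_right_mono norm_ge_zero real_norm_def)
    also have "\<dots> \<le> M * \<eta> * \<eta>"
      using M[OF zr] \<Delta>[OF \<omega> j] M0 eta by (intro mult_mono) auto
    finally show ?thesis
      using M0 eta by (simp add: reg_term_eq[OF j] \<Delta>_def power2_eq_square)
  qed
  have loss: "l (aggregate agg J (e \<omega>)) =
      l (aggregate agg J h) + (\<Sum>j<J. bias_term l agg J h j (e \<omega> j - h j)) + rem \<omega>" for \<omega>
  proof -
    have "W *v aggregate agg J (e \<omega>) = z + (\<Sum>j<J. \<Delta> \<omega> j)"
      by (simp add: \<Delta>_def aggregate_eq
          linear_sum[OF matrix_vector_mul_linear] sum_subtractf scaleR_right.sum[symmetric] algebra_simps)
    then show ?thesis
      by (simp add: rem_def bias_term_eq \<Delta>_def blinfun.sum_right)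
  qed
  \<comment> \<open>Pulling every \<open>D j\<close> back to \<open>Q\<close> puts all terms on one
    probability space. The bias terms then cancel against those in \<open>loss\<close>.\<close>
  have "measure_pmf.expectation (D j) (\<lambda>\<delta>. bias_term l agg J h j \<delta> + reg_term l agg J h j \<delta>) =
      measure_pmf.expectation Q (\<lambda>\<omega>. bias_term l agg J h j (e \<omega> j - h j))
      + measure_pmf.expectation Q (\<lambda>\<omega>. reg_term l agg J h j (e \<omega> j - h j))" if "j < J" for j
    unfolding law[OF that, symmetric] by simp
  then have "measure_pmf.expectation Q (\<lambda>\<omega>. l (aggregate agg J (e \<omega>))) - l (aggregate agg J h)
      - (\<Sum>j<J. measure_pmf.expectation (D j)
          (\<lambda>\<delta>. bias_term l agg J h j \<delta> + reg_term l agg J h j \<delta>))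
    = measure_pmf.expectation Q rem
      - (\<Sum>j<J. measure_pmf.expectation Q (\<lambda>\<omega>. reg_term l agg J h j (e \<omega> j - h j)))"
    by (simp add: loss sum.distrib)
  also have "\<dots> = measure_pmf.expectation Q
      (\<lambda>\<omega>. rem \<omega> - (\<Sum>j<J. reg_term l agg J h j (e \<omega> j - h j)))"
    by simp
  also have "\<bar>\<dots>\<bar> \<le> measure_pmf.expectation Q
      (\<lambda>\<omega>. \<bar>rem \<omega> - (\<Sum>j<J. reg_term l agg J h j (e \<omega> j - h j))\<bar>)"
    by (rule integral_abs_bound)
  also have "\<dots> \<le> 2 * M * (real J * \<eta>)\<^sup>2"
  proof (intro measure_pmf.integral_le_const int AE_pmfI)
    fix \<omega> assume \<omega>: "\<omega> \<in> set_pmf Q"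
    have "\<bar>\<Sum>j<J. reg_term l agg J h j (e \<omega> j - h j)\<bar> \<le> (\<Sum>j<J. M * \<eta>\<^sup>2)"
      using reg[OF \<omega>] by (intro order_trans[OF sum_abs] sum_mono) auto
    also have "\<dots> \<le> M * (real J * \<eta>)\<^sup>2"
    proof -
      \<comment> \<open>\<open>J\<close> terms of size \<open>M * \<eta>\<^sup>2\<close> are
        absorbed using \<open>J \<le> J\<^sup>2\<close>, valid as \<open>1 \<le> J\<close>.\<close>
      have "real J * 1 * (M * \<eta>\<^sup>2) \<le> real J * real J * (M * \<eta>\<^sup>2)"
        using J M0 by (intro mult_right_mono mult_left_mono) auto
      then show ?thesis by (simp add: power2_eq_square mult_ac)
    qed
    finally show "\<bar>rem \<omega> - (\<Sum>j<J. reg_term l agg J h j (e \<omega> j - h j))\<bar> \<le> 2 * M * (real J * \<eta>)\<^sup>2"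
      using rem[OF \<omega>] by linarith
  qed
  finally show ?thesis .
qed

end

section \<open>Finite supports and size of the perturbations under \<open>W\<close>\<close>

lemma finite_set_sampling_scheme:
  assumes "sampling_scheme J S P"
  shows "finite (set_pmf P)"
  by (rule finite_subset[of _ "Pow {..<J}"]) (use assms in \<open>auto simp: sampling_scheme_def\<close>)

text \<open>Keep flags outside \<open>{..<J}\<close> have the default value \<open>False\<close>, so
  only finitely many flag functions occur.\<close>

lemma finite_set_sed_pmf:
  assumes "sampling_scheme J S P"
  shows "finite (set_pmf (sed_pmf p J P))"
proof -
  have "set_pmf (Pi_pmf {..<J} False (\<lambda>_. bernoulli_pmf p)) \<subseteq> PiE_dflt {..<J} False (\<lambda>_. UNIV)"
    by (intro order_trans[OF set_Pi_pmf_subset']) (auto simp: PiE_dflt_def)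
  then have "finite (set_pmf (Pi_pmf {..<J} False (\<lambda>_. bernoulli_pmf p)))"
    by (rule finite_subset) auto
  then show ?thesis
    using finite_set_sampling_scheme[OF assms] by (simp add: sed_pmf_def)
qed

text \<open>The proof gives \<open>2 * \<epsilon>\<close>; the weaker factor
  \<open>real J + 2\<close> matches the SED bound, so that one \<open>\<eta>\<close> serves
  both.\<close>

lemma norm_et_perturbation_le:
  fixes W :: "real^'d^'m"
  assumes "norm (W *v h j) \<le> \<epsilon>" "norm (W *v hs j) \<le> \<epsilon>"
  shows "norm (W *v (et_embedding h hs A j - h j)) \<le> (real J + 2) * \<epsilon>"
proof -
  have "0 \<le> real J * \<epsilon>"
    using assms(1) order_trans[OF norm_ge_zero] by (intro mult_nonneg_nonneg) auto
  moreover have "norm (W *v (et_embedding h hs A j - h j)) \<le> 2 * \<epsilon>"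
    using assms norm_triangle_ineq4[of "W *v hs j" "W *v h j"] order_trans[OF norm_ge_zero assms(1)]
    by (auto simp: et_embedding_def matrix_vector_mult_diff_distrib)
  ultimately show ?thesis by (simp add: algebra_simps)
qed

text \<open>A sampled embedding is perturbed by its excess weight
  \<open>(1 - p) * (J - S) / S\<close>, at most \<open>J\<close> because \<open>1 \<le> S\<close>. A
  segment not sampled costs at most \<open>2 * \<epsilon>\<close>. The factor
  \<open>real J + 2\<close> covers both cases.\<close>

lemma norm_sed_perturbation_le:
  fixes W :: "real^'d^'m"
  assumes "norm (W *v h j) \<le> \<epsilon>" "norm (W *v hs j) \<le> \<epsilon>" "0 < S" "S \<le> J" "0 \<le> p" "p \<le> 1"
  shows "norm (W *v (sed_embedding p J S h hs \<omega> j - h j)) \<le> (real J + 2) * \<epsilon>"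
proof -
  obtain A b where \<omega>: "\<omega> = (A, b)" by (cases \<omega>)
  have eps: "0 \<le> \<epsilon>" using order_trans[OF norm_ge_zero assms(1)] .
  then have J\<epsilon>: "0 \<le> real J * \<epsilon>" by simp
  show ?thesis
  proof (cases "j \<in> A")
    case True
    define c where "c = p + (1 - p) * (real J / real S) - 1"
    have "c = (1 - p) * ((real J - real S) / real S)"
      using assms by (simp add: c_def field_simps)
    moreover have "0 \<le> (real J - real S) / real S"
      using assms by simp
    moreover have "(real J - real S) / real S \<le> real J"
      using assms divide_left_mono[of 1 "real S" "real J - real S"] by simp
    ultimately have c: "0 \<le> c" "c \<le> real J"
      using assms mult_left_le_one_le[of "(real J - real S) / real S" "1 - p"] by auto
    have "sed_embedding p J S h hs \<omega> j - h j = c *\<^sub>R h j"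
      using True by (simp add: \<omega> sed_embedding_def sed_weight_def et_embedding_def c_def scaleR_left_diff_distrib)
    then have "norm (W *v (sed_embedding p J S h hs \<omega> j - h j)) = c * norm (W *v h j)"
      using c by (simp add: matrix_vector_mult_scaleR)
    also have "\<dots> \<le> real J * \<epsilon>"
      using c assms by (intro mult_mono) auto
    finally show ?thesis using eps by (simp add: algebra_simps)
  next
    case False
    then have "norm (W *v (sed_embedding p J S h hs \<omega> j - h j)) \<le> 2 * \<epsilon>"
      using assms eps norm_triangle_ineq4[of "W *v hs j" "W *v h j"]
      by (auto simp: \<omega> sed_embedding_def sed_weight_def et_embedding_def
          matrix_vector_mult_diff_distrib)
    then show ?thesis using J\<epsilon> by (simp add: algebra_simps)
  qed
qed

section \<open>Uniform constant, and comparison of SED with ET\<close>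

theorem theorem4p1:
  fixes W :: "real^'d^'m" and G :: "real^'m \<Rightarrow> 'o" and F' :: "real^'d \<Rightarrow> 'o"
    and L :: "'o \<Rightarrow> real"
    and agg :: aggregation and J S :: nat and P :: "nat set pmf" and p :: real
  assumes head: "F' = (\<lambda>x. G (W *v x))"
    and smooth: "C2 (L \<circ> G)"
    and segments: "0 < S" "S \<le> J"
    and sampling: "sampling_scheme J S P"
    and keep_ratio: "0 \<le> p" "p \<le> 1"
  shows "\<exists>C. \<forall>\<epsilon> (h :: nat \<Rightarrow> real^'d) (hs :: nat \<Rightarrow> real^'d).
    0 \<le> \<epsilon> \<and> \<epsilon> \<le> 1 \<and> (\<forall>j<J. norm (W *v hs j) \<le> \<epsilon> \<and> norm (W *v h j) \<le> \<epsilon>) \<longrightarrow>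
    (let B = bias_term (L \<circ> F') agg J h;
         R = reg_term (L \<circ> F') agg J h;
         \<delta>_ET = (\<lambda>j. et_perturbation J S (h j) (hs j));
         \<delta>_SED = (\<lambda>j. sed_perturbation p J S (h j) (hs j));
         loss = (\<lambda>v. L (F' (aggregate agg J v)))
     in
       \<comment> \<open>Taylor approximation of the expected loss, for ET and for SED\<close>
       \<bar>measure_pmf.expectation P (\<lambda>A. loss (et_embedding h hs A)) - loss h
          - (\<Sum>j<J. measure_pmf.expectation (\<delta>_ET j) (\<lambda>\<delta>. B j \<delta> + R j \<delta>))\<bar> \<le> C * \<epsilon>\<^sup>2 \<and>
       \<bar>measure_pmf.expectation (sed_pmf p J P) (\<lambda>\<omega>. loss (sed_embedding p J S h hs \<omega>)) - loss h
          - (\<Sum>j<J. measure_pmf.expectation (\<delta>_SED j) (\<lambda>\<delta>. B j \<delta> + R j \<delta>))\<bar> \<le> C * \<epsilon>\<^sup>2 \<and>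
       \<comment> \<open>SED reduces the bias by the factor \<open>p\<close>\<close>
       (\<forall>j<J. measure_pmf.expectation (\<delta>_SED j) (B j)
              = p * measure_pmf.expectation (\<delta>_ET j) (B j)) \<and>
       \<comment> \<open>and introduces a further regularization term, in the up-to-date embedding only\<close>
       (\<forall>j<J. measure_pmf.expectation (\<delta>_SED j) (R j)
              = p * measure_pmf.expectation (\<delta>_ET j) (R j)
                + (1 - p) * (real J - real S) / real J
                  * (((1 - p) * (real J - real S) + real S) / real S) * R j (h j)))"
proof -
  define f where "f = L \<circ> G"
  have LF: "L \<circ> F' = (\<lambda>x. f (W *v x))" "\<And>x. L (F' x) = f (W *v x)"
    by (simp_all add: f_def head fun_eq_iff)
  obtain f' f'' where f': "\<And>x. (f has_derivative blinfun_apply (f' x)) (at x)"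
    and f'': "\<And>x. (f' has_derivative blinfun_apply (f'' x)) (at x)"
    and cont: "continuous_on UNIV f''"
    using smooth unfolding C2_def f_def[symmetric] by blast
  have J: "0 < J" using segments by simp
  \<comment> \<open>The value of \<open>2 * real J * \<eta>\<close> for
    \<open>\<epsilon> = 1\<close>, hence an upper bound for all \<open>\<epsilon> \<le> 1\<close>.
    As \<open>r\<close> is fixed before \<open>h\<close> and \<open>hs\<close>, compactness of the
    ball gives an \<open>M\<close>, and thus a \<open>C\<close>, uniform in the embeddings.\<close>
  define r where "r = 2 * real J * (real J + 2)"
  have "bounded (f'' ` cball 0 r)"
    using cont by (intro compact_imp_bounded compact_continuous_image) (auto intro: continuous_on_subset)
  then obtain M where "\<forall>x\<in>cball 0 r. norm (f'' x) \<le> M"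
    by (auto simp: bounded_iff)
  then have M: "\<And>x. norm x \<le> r \<Longrightarrow> norm (f'' x) \<le> M"
    by simp
  define C where "C = 2 * M * (real J * (real J + 2))\<^sup>2"
  show ?thesis
  proof (intro exI[of _ C] allI impI, goal_cases)
    case (1 \<epsilon> h hs)
    then have \<epsilon>: "0 \<le> \<epsilon>" "\<epsilon> \<le> 1"
      and h: "\<And>j. j < J \<Longrightarrow> norm (W *v h j) \<le> \<epsilon>"
      and hs: "\<And>j. j < J \<Longrightarrow> norm (W *v hs j) \<le> \<epsilon>"
      by auto
    define \<eta> where "\<eta> = (real J + 2) * \<epsilon>"
    have h\<eta>: "norm (W *v h j) \<le> \<eta>" if "j < J" for j
      using h[OF that] \<epsilon> mult_right_mono[of 1 "real J + 2" \<epsilon>] by (simp add: \<eta>_def)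
    have r\<eta>: "2 * real J * \<eta> \<le> r"
      using mult_left_mono[OF \<epsilon>(2), of "real J * (real J + 2)"] by (simp add: \<eta>_def r_def mult.assoc)
    have C: "2 * M * (real J * \<eta>)\<^sup>2 = C * \<epsilon>\<^sup>2"
      by (simp add: C_def \<eta>_def power_mult_distrib)
    have ET: "\<bar>measure_pmf.expectation P (\<lambda>A. f (W *v aggregate agg J (et_embedding h hs A)))
        - f (W *v aggregate agg J h)
        - (\<Sum>j<J. measure_pmf.expectation (et_perturbation J S (h j) (hs j))
            (\<lambda>\<delta>. bias_term (\<lambda>x. f (W *v x)) agg J h j \<delta> + reg_term (\<lambda>x. f (W *v x)) agg J h j \<delta>))\<bar>
      \<le> C * \<epsilon>\<^sup>2"
      unfolding C[symmetric]
      by (rule expected_loss_taylor_bound[OF f' f'' J finite_set_sampling_scheme[OF sampling] _ M h\<eta> _ r\<eta>])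
        (auto simp: map_pmf_et_perturbation[OF sampling] segments \<eta>_def h hs
          intro: norm_et_perturbation_le)
    have SED: "\<bar>measure_pmf.expectation (sed_pmf p J P)
          (\<lambda>\<omega>. f (W *v aggregate agg J (sed_embedding p J S h hs \<omega>)))
        - f (W *v aggregate agg J h)
        - (\<Sum>j<J. measure_pmf.expectation (sed_perturbation p J S (h j) (hs j))
            (\<lambda>\<delta>. bias_term (\<lambda>x. f (W *v x)) agg J h j \<delta> + reg_term (\<lambda>x. f (W *v x)) agg J h j \<delta>))\<bar>
      \<le> C * \<epsilon>\<^sup>2"
      unfolding C[symmetric]
      by (rule expected_loss_taylor_bound[OF f' f'' J finite_set_sed_pmf[OF sampling] _ M h\<eta> _ r\<eta>])
        (auto simp: map_pmf_sed_perturbation[OF sampling] segments keep_ratio \<eta>_def h hs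
          intro: norm_sed_perturbation_le)
    show ?case
      unfolding Let_def LF
      by (intro conjI allI impI ET SED expectation_sed_perturbation_linear linear_bias_term[OF f' f'']
          expectation_sed_perturbation_quadratic reg_term_scaleR segments keep_ratio)
  qed
qed

end
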